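(* Let $(A,N)$ be a Nijenhuis algebra and $X$ a set. Let $\tilde F(X)$ be the free left $A$-module on $X$, whose elements are the finite sums $\sum_{x\in X}a_x x$ with $a_x\in A$, and define the linear operator $N_{\tilde F(X)}:\tilde F(X)\to\tilde F(X)$ by $\sum_{x\in X}a_x x\mapsto\sum_{x\in X}N(a_x)x$. Then: (1) $(\tilde F(X),N_{\tilde F(X)})$ is a left $(A,N)$-module. (2) $(\tilde F(X),N_{\tilde F(X)})$ together with the natural embedding $j_X:X\to\tilde F(X)$ is the restricted free left $(A,N)$-module generated by $X$.
   Context: Throughout, $\mathbf{k}$ is a commutative ring with unit; all modules, algebras and linear maps are over $\mathbf{k}$; algebras are associative with unit ($1_A$ denotes the unit of $A$) and modules are unital. A Nijenhuis algebra $(A,N)$ is an algebra $A$ with a linear map $N:A\to A$ such that $N(a)N(b)=N\big(N(a)b+aN(b)-N(ab)\big)$ for all $a,b\in A$. A left $(A,N)$-module $(M,N_M)$ is a left $A$-module $M$ with a linear map $N_M:M\to M$ such that $N(a)N_M(m)=N_M\big(N(a)m+aN_M(m)-N_M(am)\big)$ for all $a\in A$, $m\in M$. A left $(A,N)$-module homomorphism $(M,N_M)\to(M',N_{M'})$ is a left $A$-module homomorphism $f:M\to M'$ with $f\circ N_M=N_{M'}\circ f$. For a left $(A,N)$-module $(M,N_M)$, put $MC(M):=\{m\in M\mid N_M(am)=N(a)m \text{ for all } a\in A\}$. A restricted free left $(A,N)$-module generated by a set $X$ is a left $(A,N)$-module $(F(X),N_{F(X)})$ together with a set map $j_X:X\to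 F(X)$ such that for any left $(A,N)$-module $(M,N_M)$ and any set map $f:X\to M$ with $\mathrm{Im}(f)\subseteq MC(M)$, there exists a unique left $(A,N)$-module homomorphism $\overline f:(F(X),N_{F(X)})\to(M,N_M)$ with $\overline f\circ j_X=f$. *)

theory Defs
  imports "HOL-Algebra.Module"
begin

text \<open>
  Associative unital algebras over a commutative ring. The locale \<open>algebra\<close> of HOL-Algebra also
  requires the multiplication to be commutative, so it cannot be used here.
\<close>

locale assoc_algebra = module K A + A?: ring A
  for K (structure) and A (structure) +
  assumes smult_mult_left:
      "\<lbrakk>c \<in> carrier K; a \<in> carrier A; b \<in> carrier A\<rbrakk>
        \<Longrightarrow> (c \<odot>\<^bsub>A\<^esub> a) \<otimes>\<^bsub>A\<^esub> b = c \<odot>\<^bsub>A\<^esub> (a \<otimes>\<^bsub>A\<^esub> b)"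
    and smult_mult_right:
      "\<lbrakk>c \<in> carrier K; a \<in> carrier A; b \<in> carrier A\<rbrakk>
        \<Longrightarrow> a \<otimes>\<^bsub>A\<^esub> (c \<odot>\<^bsub>A\<^esub> b) = c \<odot>\<^bsub>A\<^esub> (a \<otimes>\<^bsub>A\<^esub> b)"

definition linear_map ::
    "('k, 'r) ring_scheme \<Rightarrow> ('k, 'm, 's) module_scheme \<Rightarrow> ('k, 'n, 't) module_scheme
      \<Rightarrow> ('m \<Rightarrow> 'n) \<Rightarrow> bool" where
  "linear_map K M M' f \<longleftrightarrow>
     f \<in> carrier M \<rightarrow> carrier M' \<and>
     (\<forall>x\<in>carrier M. \<forall>y\<in>carrier M. f (x \<oplus>\<^bsub>M\<^esub> y) = f x \<oplus>\<^bsub>M'\<^esub> f y) \<and>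
     (\<forall>c\<in>carrier K. \<forall>x\<in>carrier M. f (c \<odot>\<^bsub>M\<^esub> x) = c \<odot>\<^bsub>M'\<^esub> f x)"

text \<open>
  A left module over a \<open>K\<close>-algebra \<open>A\<close> is a \<open>K\<close>-module (scalar multiplication \<open>\<odot>\<close>) with a
  \<open>K\<close>-bilinear, associative and unital action of \<open>A\<close> (written \<open>\<cdot>\<close>). As for every HOL-Algebra
  module, the inherited fields \<open>mult\<close> and \<open>one\<close> carry no meaning.
\<close>

record ('k, 'a, 'm) lmodule = "('k, 'm) module" +
  act :: "'a \<Rightarrow> 'm \<Rightarrow> 'm" (infixl \<open>\<cdot>\<index>\<close> 70)

locale left_module = A?: assoc_algebra K A + M?: module K M
  for K (structure) and A (structure) and M (structure) +
  assumes act_closed: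
      "\<lbrakk>a \<in> carrier A; m \<in> carrier M\<rbrakk> \<Longrightarrow> a \<cdot>\<^bsub>M\<^esub> m \<in> carrier M"
    and act_add_left:
      "\<lbrakk>a \<in> carrier A; b \<in> carrier A; m \<in> carrier M\<rbrakk>
        \<Longrightarrow> (a \<oplus>\<^bsub>A\<^esub> b) \<cdot>\<^bsub>M\<^esub> m = a \<cdot>\<^bsub>M\<^esub> m \<oplus>\<^bsub>M\<^esub> b \<cdot>\<^bsub>M\<^esub> m"
    and act_add_right:
      "\<lbrakk>a \<in> carrier A; m \<in> carrier M; n \<in> carrier M\<rbrakk>
        \<Longrightarrow> a \<cdot>\<^bsub>M\<^esub> (m \<oplus>\<^bsub>M\<^esub> n) = a \<cdot>\<^bsub>M\<^esub> m \<oplus>\<^bsub>M\<^esub> a \<cdot>\<^bsub>M\<^esub> n"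
    and act_smult_left:
      "\<lbrakk>c \<in> carrier K; a \<in> carrier A; m \<in> carrier M\<rbrakk>
        \<Longrightarrow> (c \<odot>\<^bsub>A\<^esub> a) \<cdot>\<^bsub>M\<^esub> m = c \<odot>\<^bsub>M\<^esub> (a \<cdot>\<^bsub>M\<^esub> m)"
    and act_smult_right:
      "\<lbrakk>c \<in> carrier K; a \<in> carrier A; m \<in> carrier M\<rbrakk>
        \<Longrightarrow> a \<cdot>\<^bsub>M\<^esub> (c \<odot>\<^bsub>M\<^esub> m) = c \<odot>\<^bsub>M\<^esub> (a \<cdot>\<^bsub>M\<^esub> m)"
    and act_mult:
      "\<lbrakk>a \<in> carrier A; b \<in> carrier A; m \<in> carrier M\<rbrakk>
        \<Longrightarrow> (a \<otimes>\<^bsub>A\<^esub> b) \<cdot>\<^bsub>M\<^esub> m = a \<cdot>\<^bsub>M\<^esub> (b \<cdot>\<^bsub>M\<^esub> m)"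
    and act_one:
      "m \<in> carrier M \<Longrightarrow> \<one>\<^bsub>A\<^esub> \<cdot>\<^bsub>M\<^esub> m = m"

definition left_module_hom ::
    "('k, 'r) ring_scheme \<Rightarrow> ('k, 'a, 'u) module_scheme
      \<Rightarrow> ('k, 'a, 'm, 's) lmodule_scheme \<Rightarrow> ('k, 'a, 'n, 't) lmodule_scheme
      \<Rightarrow> ('m \<Rightarrow> 'n) \<Rightarrow> bool" where
  "left_module_hom K A M M' f \<longleftrightarrow>
     linear_map K M M' f \<and>
     (\<forall>a\<in>carrier A. \<forall>m\<in>carrier M. f (a \<cdot>\<^bsub>M\<^esub> m) = a \<cdot>\<^bsub>M'\<^esub> f m)"

locale nijenhuis_algebra = assoc_algebra K A
  for K (structure) and A (structure) and N +
  assumes N_linear: "linear_map K A A N"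
    and nijenhuis:
      "\<lbrakk>a \<in> carrier A; b \<in> carrier A\<rbrakk>
        \<Longrightarrow> N a \<otimes>\<^bsub>A\<^esub> N b = N (N a \<otimes>\<^bsub>A\<^esub> b \<oplus>\<^bsub>A\<^esub> a \<otimes>\<^bsub>A\<^esub> N b \<ominus>\<^bsub>A\<^esub> N (a \<otimes>\<^bsub>A\<^esub> b))"

locale nijenhuis_left_module = nijenhuis_algebra K A N + left_module K A M
  for K (structure) and A (structure) and N and M (structure) and NM +
  assumes NM_linear: "linear_map K M M NM"
    and nijenhuis_act:
      "\<lbrakk>a \<in> carrier A; m \<in> carrier M\<rbrakk>
        \<Longrightarrow> N a \<cdot>\<^bsub>M\<^esub> NM m = NM (N a \<cdot>\<^bsub>M\<^esub> m \<oplus>\<^bsub>M\<^esub> a \<cdot>\<^bsub>M\<^esub> NM m \<ominus>\<^bsub>M\<^esub> NM (a \<cdot>\<^bsub>M\<^esub> m))"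

definition nijenhuis_module_hom ::
    "('k, 'r) ring_scheme \<Rightarrow> ('k, 'a, 'u) module_scheme
      \<Rightarrow> ('k, 'a, 'm, 's) lmodule_scheme \<Rightarrow> ('m \<Rightarrow> 'm)
      \<Rightarrow> ('k, 'a, 'n, 't) lmodule_scheme \<Rightarrow> ('n \<Rightarrow> 'n)
      \<Rightarrow> ('m \<Rightarrow> 'n) \<Rightarrow> bool" where
  "nijenhuis_module_hom K A M NM M' NM' f \<longleftrightarrow>
     left_module_hom K A M M' f \<and> (\<forall>m\<in>carrier M. f (NM m) = NM' (f m))"

definition MC ::
    "('k, 'a, 'u) module_scheme \<Rightarrow> ('a \<Rightarrow> 'a)
      \<Rightarrow> ('k, 'a, 'm, 's) lmodule_scheme \<Rightarrow> ('m \<Rightarrow> 'm) \<Rightarrow> 'm set" where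
  "MC A N M NM = {m \<in> carrier M. \<forall>a\<in>carrier A. NM (a \<cdot>\<^bsub>M\<^esub> m) = N a \<cdot>\<^bsub>M\<^esub> m}"

text \<open>
  HOL cannot quantify over types inside a formula, so the type of the elements of the test modules
  \<open>M\<close> is passed as the argument \<open>T\<close>; in a theorem about \<open>TYPE('m)\<close> it is universally quantified.
  Maps on a carrier are represented by functions that are \<open>extensional\<close> on it, so that \<open>\<exists>!\<close> does not
  see values outside the carrier.
\<close>

definition restricted_free_left_module ::
    "'m itself \<Rightarrow> ('k, 'r) ring_scheme \<Rightarrow> ('k, 'a, 'u) module_scheme \<Rightarrow> ('a \<Rightarrow> 'a)
      \<Rightarrow> 'x set \<Rightarrow> ('k, 'a, 'f, 's) lmodule_scheme \<Rightarrow> ('f \<Rightarrow> 'f) \<Rightarrow> ('x \<Rightarrow> 'f) \<Rightarrow> bool" where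
  "restricted_free_left_module T K A N X F NF j \<longleftrightarrow>
     nijenhuis_left_module K A N F NF \<and>
     j \<in> X \<rightarrow> carrier F \<and>
     (\<forall>(M :: ('k, 'a, 'm) lmodule) NM f.
        nijenhuis_left_module K A N M NM \<and> f \<in> X \<rightarrow> carrier M \<and> f ` X \<subseteq> MC A N M NM \<longrightarrow>
        (\<exists>!g. g \<in> extensional (carrier F) \<and>
              nijenhuis_module_hom K A F NF M NM g \<and>
              (\<forall>x\<in>X. g (j x) = f x)))"

text \<open>
  The formal sum of \<open>a x\<close> times \<open>x\<close> over \<open>x \<in> X\<close> is represented by its coefficient function \<open>a\<close>,
  which has finite support contained in \<open>X\<close>.
\<close>

definition free_left_module ::
    "('k, 'a, 'u) module_scheme \<Rightarrow> 'x set \<Rightarrow> ('k, 'a, 'x \<Rightarrow> 'a) lmodule" where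
  "free_left_module A X =
    \<lparr> carrier = {u. (\<forall>x. u x \<in> carrier A) \<and> (\<forall>x. x \<notin> X \<longrightarrow> u x = \<zero>\<^bsub>A\<^esub>)
                    \<and> finite {x. u x \<noteq> \<zero>\<^bsub>A\<^esub>}},
      mult = undefined,
      one = undefined,
      zero = (\<lambda>x. \<zero>\<^bsub>A\<^esub>),
      add = (\<lambda>u v x. u x \<oplus>\<^bsub>A\<^esub> v x),
      smult = (\<lambda>c u x. c \<odot>\<^bsub>A\<^esub> u x),
      act = (\<lambda>a u x. a \<otimes>\<^bsub>A\<^esub> u x) \<rparr>"

definition free_embedding :: "('k, 'a, 'u) module_scheme \<Rightarrow> 'x \<Rightarrow> 'x \<Rightarrow> 'a" where
  "free_embedding A x = (\<lambda>y. if y = x then \<one>\<^bsub>A\<^esub> else \<zero>\<^bsub>A\<^esub>)"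

definition free_operator :: "('a \<Rightarrow> 'a) \<Rightarrow> ('x \<Rightarrow> 'a) \<Rightarrow> 'x \<Rightarrow> 'a" where
  "free_operator N u = (\<lambda>x. N (u x))"

end

theory Submission
  imports Defs
begin

text \<open>
  The free module \<open>F\<close> consists of the finitely supported coefficient functions \<open>X \<rightarrow> A\<close> with
  pointwise operations, and its operator applies \<open>N\<close> to each coefficient. Hence every axiom of a
  left \<open>(A, N)\<close>-module holds in \<open>F\<close> because it holds for \<open>A\<close> acting on itself, coefficient by
  coefficient; only finiteness of the support needs an argument, and there \<open>N 0 = 0\<close> is used.

  For the universal property, the extension of \<open>f\<close> can only be \<open>\<Sum> a\<^sub>x x \<mapsto> \<Sum> a\<^sub>x f(x)\<close>, which is
  additive. An additive map on \<open>F\<close> is determined by its values on the monomials \<open>a x\<close>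
  (\<open>additive_eq_if_eq_on_monomials\<close>), and this one principle gives everything else. Two
  homomorphisms that extend \<open>f\<close> both send \<open>a x\<close> to \<open>a f(x)\<close>, hence are equal. Each compatibility of
  the extension \<open>g\<close> (with scalars, with the action and with the operators) is an equality of two
  additive maps, so it need only be checked on monomials. For the operators the equation on the
  monomial \<open>a x\<close> reads \<open>N(a) f(x) = N\<^sub>M (a f(x))\<close>, which says exactly that \<open>f(x)\<close> lies in
  \<open>MC(M)\<close>.
\<close>

section \<open>The free module is a left Nijenhuis module\<close>

lemma free_left_module_simps [simp]:
  "zero (free_left_module A X) = (\<lambda>x. \<zero>\<^bsub>A\<^esub>)"
  "u \<oplus>\<^bsub>free_left_module A X\<^esub> v = (\<lambda>x. u x \<oplus>\<^bsub>A\<^esub> v x)"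
  "c \<odot>\<^bsub>free_left_module A X\<^esub> u = (\<lambda>x. c \<odot>\<^bsub>A\<^esub> u x)"
  "a \<cdot>\<^bsub>free_left_module A X\<^esub> u = (\<lambda>x. a \<otimes>\<^bsub>A\<^esub> u x)"
  by (simp_all add: free_left_module_def)

lemma mem_free_left_module:
  "u \<in> carrier (free_left_module A X) \<longleftrightarrow>
    (\<forall>x. u x \<in> carrier A) \<and> (\<forall>x. x \<notin> X \<longrightarrow> u x = \<zero>\<^bsub>A\<^esub>) \<and> finite {x. u x \<noteq> \<zero>\<^bsub>A\<^esub>}"
  by (simp add: free_left_module_def)

lemma free_left_module_coeff_closed:
  "u \<in> carrier (free_left_module A X) \<Longrightarrow> u x \<in> carrier A"
  by (simp add: mem_free_left_module)

text \<open>
  The pointwise operations preserve finiteness of the support because they produce \<open>\<zero>\<close> wherever all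
  their arguments are \<open>\<zero>\<close>.
\<close>

lemma free_left_module_closed_pointwise:
  assumes u: "u \<in> carrier (free_left_module A X)" and v: "v \<in> carrier (free_left_module A X)"
    and closed: "\<And>x. w x \<in> carrier A"
    and zero: "\<And>x. u x = \<zero>\<^bsub>A\<^esub> \<Longrightarrow> v x = \<zero>\<^bsub>A\<^esub> \<Longrightarrow> w x = \<zero>\<^bsub>A\<^esub>"
  shows "w \<in> carrier (free_left_module A X)"
proof -
  have "{x. w x \<noteq> \<zero>\<^bsub>A\<^esub>} \<subseteq> {x. u x \<noteq> \<zero>\<^bsub>A\<^esub>} \<union> {x. v x \<noteq> \<zero>\<^bsub>A\<^esub>}"
    using zero by blast
  then have "finite {x. w x \<noteq> \<zero>\<^bsub>A\<^esub>}"
    by (rule finite_subset) (use u v in \<open>simp add: mem_free_left_module\<close>)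
  then show ?thesis
    using u v closed zero by (simp add: mem_free_left_module)
qed

context assoc_algebra
begin

lemma left_module_free: "left_module K A (free_left_module A X)"
proof -
  let ?F = "free_left_module A X"
  note coeff = free_left_module_coeff_closed[where A = A and X = X]
  have neg: "(\<lambda>x. \<ominus>\<^bsub>A\<^esub> u x) \<in> carrier ?F" if "u \<in> carrier ?F" for u
    by (rule free_left_module_closed_pointwise[OF that that]) (simp_all add: coeff[OF that])
  have "abelian_group ?F"
  proof (rule abelian_groupI)
    fix u assume u: "u \<in> carrier ?F"
    show "\<exists>v\<in>carrier ?F. v \<oplus>\<^bsub>?F\<^esub> u = \<zero>\<^bsub>?F\<^esub>"
      using neg[OF u] by (rule rev_bexI) (simp add: coeff[OF u] l_neg)
  next
    fix u v assume "u \<in> carrier ?F" "v \<in> carrier ?F"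
    then show "u \<oplus>\<^bsub>?F\<^esub> v \<in> carrier ?F"
      by (rule free_left_module_closed_pointwise) (use \<open>u \<in> _\<close> \<open>v \<in> _\<close> in \<open>simp_all add: coeff\<close>)
  qed (auto simp: mem_free_left_module M.a_ac)
  moreover have smult: "c \<odot>\<^bsub>?F\<^esub> u \<in> carrier ?F"
    if "c \<in> carrier K" "u \<in> carrier ?F" for c u
    by (rule free_left_module_closed_pointwise[OF that(2) that(2)])
      (use that in \<open>simp_all add: coeff\<close>)
  moreover have act: "a \<cdot>\<^bsub>?F\<^esub> u \<in> carrier ?F"
    if "a \<in> carrier A" "u \<in> carrier ?F" for a u
    by (rule free_left_module_closed_pointwise[OF that(2) that(2)])
      (use that in \<open>simp_all add: coeff\<close>)
  ultimately have "module K ?F"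
    by (intro module.intro module_axioms.intro R.cring_axioms)
      (auto simp: coeff smult_l_distr smult_r_distr smult_assoc1)
  then show ?thesis
    using act
    by (intro left_module.intro left_module_axioms.intro assoc_algebra_axioms)
      (auto simp: coeff A.l_distr A.r_distr A.m_assoc smult_mult_left smult_mult_right)
qed

lemma a_minus_free:
  assumes "u \<in> carrier (free_left_module A X)" and "v \<in> carrier (free_left_module A X)"
  shows "u \<ominus>\<^bsub>free_left_module A X\<^esub> v = (\<lambda>x. u x \<ominus>\<^bsub>A\<^esub> v x)"
proof -
  let ?F = "free_left_module A X"
  interpret F: left_module K A ?F by (rule left_module_free)
  note coeff = free_left_module_coeff_closed[where A = A and X = X]
  have neg: "(\<lambda>x. \<ominus>\<^bsub>A\<^esub> v x) \<in> carrier ?F"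
    by (rule free_left_module_closed_pointwise[OF assms(2) assms(2)])
      (simp_all add: coeff[OF assms(2)])
  have "\<ominus>\<^bsub>?F\<^esub> v = (\<lambda>x. \<ominus>\<^bsub>A\<^esub> v x)"
    by (rule F.M.minus_equality) (use neg assms(2) coeff in \<open>simp_all add: l_neg\<close>)
  then show ?thesis
    by (simp add: a_minus_def)
qed

end

text \<open>Applied to \<open>N\<close> as a map from \<open>A\<close> to \<open>A\<close>, this provides \<open>N 0 = 0\<close>, which keeps the support finite under \<open>N\<close>.\<close>

lemma (in module) linear_map_zero:
  assumes "linear_map R M M' h" and "module R M'"
  shows "h \<zero>\<^bsub>M\<^esub> = \<zero>\<^bsub>M'\<^esub>"
proof -
  interpret M': module R M' by fact
  have h0: "h \<zero>\<^bsub>M\<^esub> \<in> carrier M'"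
    using assms(1) by (auto simp: linear_map_def)
  have "h (\<zero>\<^bsub>R\<^esub> \<odot>\<^bsub>M\<^esub> \<zero>\<^bsub>M\<^esub>) = \<zero>\<^bsub>R\<^esub> \<odot>\<^bsub>M'\<^esub> h \<zero>\<^bsub>M\<^esub>"
    using assms(1) unfolding linear_map_def by blast
  then show ?thesis
    using h0 by simp
qed

lemma (in nijenhuis_algebra) nijenhuis_left_module_free:
  "nijenhuis_left_module K A N (free_left_module A X) (free_operator N)"
proof -
  let ?F = "free_left_module A X"
  interpret F: left_module K A ?F by (rule left_module_free)
  note coeff = free_left_module_coeff_closed[where A = A and X = X]
  have N_closed: "N a \<in> carrier A" if "a \<in> carrier A" for a
    using N_linear that by (auto simp: linear_map_def)
  have N_zero: "N \<zero>\<^bsub>A\<^esub> = \<zero>\<^bsub>A\<^esub>"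
    by (rule linear_map_zero[OF N_linear module_axioms])
  have N_free: "free_operator N u \<in> carrier ?F" if "u \<in> carrier ?F" for u
    by (rule free_left_module_closed_pointwise[OF that that])
      (simp_all add: free_operator_def N_zero N_closed coeff[OF that])
  have "linear_map K ?F ?F (free_operator N)"
    using N_linear N_free
    by (auto simp: linear_map_def free_operator_def coeff)
  moreover have "N a \<cdot>\<^bsub>?F\<^esub> free_operator N u =
      free_operator N (N a \<cdot>\<^bsub>?F\<^esub> u \<oplus>\<^bsub>?F\<^esub> a \<cdot>\<^bsub>?F\<^esub> free_operator N u
        \<ominus>\<^bsub>?F\<^esub> free_operator N (a \<cdot>\<^bsub>?F\<^esub> u))"
    if a: "a \<in> carrier A" and u: "u \<in> carrier ?F" for a u
  proof -
    have "N a \<cdot>\<^bsub>?F\<^esub> u \<oplus>\<^bsub>?F\<^esub> a \<cdot>\<^bsub>?F\<^esub> free_operator N u \<in> carrier ?F"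
      by (intro F.M.a_closed F.act_closed N_closed N_free a u)
    moreover have "free_operator N (a \<cdot>\<^bsub>?F\<^esub> u) \<in> carrier ?F"
      by (intro F.act_closed N_free a u)
    ultimately show ?thesis
      using nijenhuis[OF a coeff[OF u]] by (simp add: a_minus_free) (simp add: free_operator_def)
  qed
  ultimately show ?thesis
    by (intro nijenhuis_left_module.intro nijenhuis_left_module_axioms.intro
        nijenhuis_algebra_axioms left_module_free)
qed

section \<open>Additive maps on the free module\<close>

abbreviation additive where
  "additive M M' h \<equiv> h \<in> hom (add_monoid M) (add_monoid M')"

lemma additiveD:
  assumes "additive M M' h"
  shows "x \<in> carrier M \<Longrightarrow> h x \<in> carrier M'"
    and "x \<in> carrier M \<Longrightarrow> y \<in> carrier M \<Longrightarrow> h (x \<oplus>\<^bsub>M\<^esub> y) = h x \<oplus>\<^bsub>M'\<^esub> h y"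
  using assms by (auto simp: hom_def)

lemma additive_comp: "additive M M' g \<Longrightarrow> additive M' M'' h \<Longrightarrow> additive M M'' (\<lambda>x. h (g x))"
  by (auto simp: hom_def Pi_iff)

lemma linear_map_additive: "linear_map K M M' h \<Longrightarrow> additive M M' h"
  by (auto simp: linear_map_def hom_def)

lemma (in module) additive_smult: "c \<in> carrier R \<Longrightarrow> additive M M (\<lambda>m. c \<odot>\<^bsub>M\<^esub> m)"
  by (auto simp: hom_def smult_r_distr)

lemma (in left_module) additive_act: "a \<in> carrier A \<Longrightarrow> additive M M (\<lambda>m. a \<cdot>\<^bsub>M\<^esub> m)"
  by (auto simp: hom_def act_closed act_add_right)

lemma (in left_module) act_zero_left:
  assumes "m \<in> carrier M"
  shows "\<zero>\<^bsub>A\<^esub> \<cdot>\<^bsub>M\<^esub> m = \<zero>\<^bsub>M\<^esub>"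
proof -
  have "(\<zero>\<^bsub>K\<^esub> \<odot>\<^bsub>A\<^esub> \<zero>\<^bsub>A\<^esub>) \<cdot>\<^bsub>M\<^esub> m = \<zero>\<^bsub>K\<^esub> \<odot>\<^bsub>M\<^esub> (\<zero>\<^bsub>A\<^esub> \<cdot>\<^bsub>M\<^esub> m)"
    using assms by (intro act_smult_left) auto
  then show ?thesis
    using assms by (simp add: act_closed)
qed

context assoc_algebra
begin

lemma free_embedding_closed:
  "x \<in> X \<Longrightarrow> free_embedding A x \<in> carrier (free_left_module A X)"
  by (auto simp: mem_free_left_module free_embedding_def)

lemma monomial_eq:
  "a \<in> carrier A \<Longrightarrow>
    a \<cdot>\<^bsub>free_left_module A X\<^esub> free_embedding A x = (\<lambda>y. if y = x then a else \<zero>\<^bsub>A\<^esub>)"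
  by (auto simp: free_embedding_def)

text \<open>
  Additive maps that agree on the monomials agree everywhere, since every element is a finite sum
  of monomials: splitting off the coefficient at one point of the support leaves an element of
  smaller support, so the claim follows by induction on the support.
\<close>

lemma additive_eq_if_eq_on_monomials:
  fixes X :: "'x set"
  assumes M: "abelian_group M"
    and p: "additive (free_left_module A X) M p" and q: "additive (free_left_module A X) M q"
    and eq: "\<And>a x. \<lbrakk>a \<in> carrier A; x \<in> X\<rbrakk> \<Longrightarrow>
      p (a \<cdot>\<^bsub>free_left_module A X\<^esub> free_embedding A x) =
      q (a \<cdot>\<^bsub>free_left_module A X\<^esub> free_embedding A x)"
    and u: "u \<in> carrier (free_left_module A X)"
  shows "p u = q u"
proof -
  let ?F = "free_left_module A X"
  interpret F: left_module K A ?F by (rule left_module_free)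
  interpret M: abelian_group M by (rule M)
  have zero: "h \<zero>\<^bsub>?F\<^esub> = \<zero>\<^bsub>M\<^esub>" if "additive ?F M h" for h
    using hom_one[OF that F.M.a_group M.a_group] by simp
  have on_support: "p u = q u" if "finite S" "u \<in> carrier ?F" "\<And>x. x \<notin> S \<Longrightarrow> u x = \<zero>\<^bsub>A\<^esub>" for S u
    using that
  proof (induction S arbitrary: u rule: finite_induct)
    case empty
    then have "u = \<zero>\<^bsub>?F\<^esub>" by auto
    then show ?case using zero[OF p] zero[OF q] by simp
  next
    case (insert x S)
    let ?w = "u(x := \<zero>\<^bsub>A\<^esub>)" and ?m = "u x \<cdot>\<^bsub>?F\<^esub> free_embedding A x"
    have coeff: "u y \<in> carrier A" for y
      using insert.prems(1) by (rule free_left_module_coeff_closed)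
    have w: "?w \<in> carrier ?F"
      by (rule free_left_module_closed_pointwise[OF insert.prems(1) insert.prems(1)])
        (auto simp: coeff)
    have pq_w: "p ?w = q ?w"
      by (rule insert.IH[OF w]) (use insert.prems(2) in auto)
    show ?case
    proof (cases "x \<in> X")
      case True
      have m: "?m \<in> carrier ?F"
        by (intro F.act_closed coeff free_embedding_closed True)
      have u_eq: "u = ?w \<oplus>\<^bsub>?F\<^esub> ?m"
        using coeff by (auto simp: monomial_eq simp del: free_left_module_simps(4))
      have "p (?w \<oplus>\<^bsub>?F\<^esub> ?m) = q (?w \<oplus>\<^bsub>?F\<^esub> ?m)"
        by (simp only: additiveD(2)[OF p w m] additiveD(2)[OF q w m] pq_w eq[OF coeff True])
      then show ?thesis
        by (simp only: u_eq[symmetric])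
    next
      case False
      then have "?w = u"
        using insert.prems(1) by (auto simp: mem_free_left_module)
      then show ?thesis using pq_w by simp
    qed
  qed
  show ?thesis
    by (rule on_support[of "{x. u x \<noteq> \<zero>\<^bsub>A\<^esub>}"]) (use u in \<open>auto simp: mem_free_left_module\<close>)
qed

end

section \<open>The universal property\<close>

definition free_lift ::
    "('k, 'a, 'u) module_scheme \<Rightarrow> ('k, 'a, 'm, 's) lmodule_scheme \<Rightarrow> ('x \<Rightarrow> 'm)
      \<Rightarrow> ('x \<Rightarrow> 'a) \<Rightarrow> 'm" where
  "free_lift A M f u = (\<Oplus>\<^bsub>M\<^esub>x\<in>{x. u x \<noteq> \<zero>\<^bsub>A\<^esub>}. u x \<cdot>\<^bsub>M\<^esub> f x)"

context left_module
begin

text \<open>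
  Summing over a common finite set that contains the supports involved makes the lift visibly
  additive. Only points of \<open>X\<close> may occur in that set, as \<open>f\<close> is unspecified elsewhere.
\<close>

lemma free_lift_eq:
  assumes f: "f \<in> X \<rightarrow> carrier M" and u: "\<And>x. u x \<in> carrier A"
    and S: "finite S" "S \<subseteq> X" "\<And>x. x \<notin> S \<Longrightarrow> u x = \<zero>\<^bsub>A\<^esub>"
  shows "free_lift A M f u = (\<Oplus>\<^bsub>M\<^esub>x\<in>S. u x \<cdot>\<^bsub>M\<^esub> f x)"
  unfolding free_lift_def
proof (rule M.add.finprod_mono_neutral_cong_left)
  show "{x. u x \<noteq> \<zero>\<^bsub>A\<^esub>} \<subseteq> S" using S(3) by auto
  show "u x \<cdot>\<^bsub>M\<^esub> f x = \<zero>\<^bsub>M\<^esub>" if "x \<in> S - {x. u x \<noteq> \<zero>\<^bsub>A\<^esub>}" for x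
    using that S(2) f by (auto intro!: act_zero_left)
  show "(\<lambda>x. u x \<cdot>\<^bsub>M\<^esub> f x) \<in> S \<rightarrow> carrier M"
    using S(2) f u by (auto intro!: act_closed)
qed (simp_all add: S(1))

lemma additive_free_lift:
  assumes f: "f \<in> X \<rightarrow> carrier M"
  shows "additive (free_left_module A X) M (free_lift A M f)"
proof -
  let ?F = "free_left_module A X"
  have term_closed: "(\<lambda>x. u x \<cdot>\<^bsub>M\<^esub> f x) \<in> S \<rightarrow> carrier M"
    if "u \<in> carrier ?F" "S \<subseteq> X" for u S
    using that f by (auto intro!: act_closed simp: mem_free_left_module)
  have "free_lift A M f u \<in> carrier M" if "u \<in> carrier ?F" for u
    unfolding free_lift_def
    by (intro M.finsum_closed term_closed that) (use that in \<open>auto simp: mem_free_left_module\<close>)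
  moreover have "free_lift A M f (u \<oplus>\<^bsub>?F\<^esub> v) = free_lift A M f u \<oplus>\<^bsub>M\<^esub> free_lift A M f v"
    if u: "u \<in> carrier ?F" and v: "v \<in> carrier ?F" for u v
  proof -
    let ?S = "{x. u x \<noteq> \<zero>\<^bsub>A\<^esub>} \<union> {x. v x \<noteq> \<zero>\<^bsub>A\<^esub>}"
    have coeff: "u x \<in> carrier A" "v x \<in> carrier A" for x
      using u v by (simp_all add: mem_free_left_module)
    have S: "finite ?S" "?S \<subseteq> X"
      using u v by (auto simp: mem_free_left_module)
    have "free_lift A M f (u \<oplus>\<^bsub>?F\<^esub> v) = (\<Oplus>\<^bsub>M\<^esub>x\<in>?S. (u x \<oplus>\<^bsub>A\<^esub> v x) \<cdot>\<^bsub>M\<^esub> f x)"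
      using free_lift_eq[OF f _ S, of "u \<oplus>\<^bsub>?F\<^esub> v"] by (simp add: coeff)
    also have "\<dots> = (\<Oplus>\<^bsub>M\<^esub>x\<in>?S. u x \<cdot>\<^bsub>M\<^esub> f x \<oplus>\<^bsub>M\<^esub> v x \<cdot>\<^bsub>M\<^esub> f x)"
      using S(2) f
      by (intro M.finsum_cong' refl) (auto intro!: M.a_closed act_closed act_add_left coeff)
    also have "\<dots> = (\<Oplus>\<^bsub>M\<^esub>x\<in>?S. u x \<cdot>\<^bsub>M\<^esub> f x) \<oplus>\<^bsub>M\<^esub> (\<Oplus>\<^bsub>M\<^esub>x\<in>?S. v x \<cdot>\<^bsub>M\<^esub> f x)"
      by (intro M.finsum_addf term_closed u v S(2))
    also have "\<dots> = free_lift A M f u \<oplus>\<^bsub>M\<^esub> free_lift A M f v"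
      using free_lift_eq[OF f coeff(1) S] free_lift_eq[OF f coeff(2) S] by simp
    finally show ?thesis .
  qed
  ultimately show ?thesis
    by (auto simp: hom_def)
qed

lemma free_lift_monomial:
  assumes f: "f \<in> X \<rightarrow> carrier M" and "a \<in> carrier A" and x: "x \<in> X"
  shows "free_lift A M f (a \<cdot>\<^bsub>free_left_module A X\<^esub> free_embedding A x) = a \<cdot>\<^bsub>M\<^esub> f x"
proof -
  have "a \<cdot>\<^bsub>M\<^esub> f x \<in> carrier M"
    using assms by (auto intro: act_closed)
  then show ?thesis
    unfolding monomial_eq[OF assms(2)]
    by (subst free_lift_eq[OF f, where S = "{x}"]) (use assms(2) x in auto)
qed

end

text \<open>
  The extension of \<open>f\<close> to a homomorphism. Each compatibility is an equality between two additive
  maps on the free module, so it reduces to monomials, where it is an axiom of the module or, for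
  the operators, membership of \<open>f x\<close> in \<open>MC\<close>.
\<close>

lemma (in nijenhuis_left_module) nijenhuis_module_hom_free_lift:
  assumes f: "f \<in> X \<rightarrow> carrier M" and MC: "f ` X \<subseteq> MC A N M NM"
  shows "nijenhuis_module_hom K A (free_left_module A X) (free_operator N) M NM (free_lift A M f)"
proof -
  let ?F = "free_left_module A X" and ?g = "free_lift A M f"
  interpret F: nijenhuis_left_module K A N ?F "free_operator N"
    by (rule nijenhuis_left_module_free)
  note g = additive_free_lift[OF f] and on_monomial = free_lift_monomial[OF f]
  note ext = additive_eq_if_eq_on_monomials[OF M.abelian_group_axioms]
  have A_module: "module K A" by unfold_locales
  have embedding: "free_embedding A x \<in> carrier ?F" if "x \<in> X" for x
    using that by (rule free_embedding_closed)
  have f_closed: "f x \<in> carrier M" if "x \<in> X" for x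
    using f that by auto
  have N_closed: "N a \<in> carrier A" if "a \<in> carrier A" for a
    using N_linear that by (auto simp: linear_map_def)
  have smult: "?g (c \<odot>\<^bsub>?F\<^esub> u) = c \<odot>\<^bsub>M\<^esub> ?g u" if c: "c \<in> carrier K" and "u \<in> carrier ?F" for c u
  proof (rule ext[OF additive_comp[OF F.additive_smult[OF c] g]
        additive_comp[OF g M.additive_smult[OF c]] _ that(2)])
    fix a x assume ax: "a \<in> carrier A" "x \<in> X"
    have "?g (c \<odot>\<^bsub>?F\<^esub> (a \<cdot>\<^bsub>?F\<^esub> free_embedding A x)) = ?g ((c \<odot>\<^bsub>A\<^esub> a) \<cdot>\<^bsub>?F\<^esub> free_embedding A x)"
      by (simp only: F.act_smult_left[OF c ax(1) embedding[OF ax(2)]])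
    then show "?g (c \<odot>\<^bsub>?F\<^esub> (a \<cdot>\<^bsub>?F\<^esub> free_embedding A x)) =
        c \<odot>\<^bsub>M\<^esub> ?g (a \<cdot>\<^bsub>?F\<^esub> free_embedding A x)"
      using ax c by (simp only: on_monomial act_smult_left f_closed module.smult_closed[OF A_module])
  qed
  have act: "?g (b \<cdot>\<^bsub>?F\<^esub> u) = b \<cdot>\<^bsub>M\<^esub> ?g u"
    if b: "b \<in> carrier A" and "u \<in> carrier ?F" for b u
  proof (rule ext[OF additive_comp[OF F.additive_act[OF b] g]
        additive_comp[OF g additive_act[OF b]] _ that(2)])
    fix a x assume ax: "a \<in> carrier A" "x \<in> X"
    have "?g (b \<cdot>\<^bsub>?F\<^esub> (a \<cdot>\<^bsub>?F\<^esub> free_embedding A x)) = ?g ((b \<otimes>\<^bsub>A\<^esub> a) \<cdot>\<^bsub>?F\<^esub> free_embedding A x)"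
      by (simp only: F.act_mult[OF b ax(1) embedding[OF ax(2)]])
    then show "?g (b \<cdot>\<^bsub>?F\<^esub> (a \<cdot>\<^bsub>?F\<^esub> free_embedding A x)) =
        b \<cdot>\<^bsub>M\<^esub> ?g (a \<cdot>\<^bsub>?F\<^esub> free_embedding A x)"
      using ax b by (simp only: on_monomial act_mult f_closed A.m_closed)
  qed
  have operator: "?g (free_operator N u) = NM (?g u)" if "u \<in> carrier ?F" for u
  proof (rule ext[OF additive_comp[OF linear_map_additive[OF F.NM_linear] g]
        additive_comp[OF g linear_map_additive[OF NM_linear]] _ that])
    fix a x assume ax: "a \<in> carrier A" "x \<in> X"
    have "N \<zero>\<^bsub>A\<^esub> = \<zero>\<^bsub>A\<^esub>"
      by (rule module.linear_map_zero[OF A_module N_linear A_module])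
    then have "free_operator N (a \<cdot>\<^bsub>?F\<^esub> free_embedding A x) = N a \<cdot>\<^bsub>?F\<^esub> free_embedding A x"
      unfolding monomial_eq[OF ax(1)] monomial_eq[OF N_closed[OF ax(1)]]
      by (auto simp: free_operator_def)
    then have "?g (free_operator N (a \<cdot>\<^bsub>?F\<^esub> free_embedding A x)) = N a \<cdot>\<^bsub>M\<^esub> f x"
      using ax by (simp only: on_monomial N_closed)
    also have "\<dots> = NM (a \<cdot>\<^bsub>M\<^esub> f x)"
    proof -
      have "f x \<in> MC A N M NM"
        using MC ax(2) by blast
      then show ?thesis
        using ax(1) by (simp add: MC_def)
    qed
    finally show "?g (free_operator N (a \<cdot>\<^bsub>?F\<^esub> free_embedding A x)) =
        NM (?g (a \<cdot>\<^bsub>?F\<^esub> free_embedding A x))"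
      using ax by (simp only: on_monomial)
  qed
  show ?thesis
    unfolding nijenhuis_module_hom_def left_module_hom_def linear_map_def
    by (intro conjI ballI Pi_I additiveD[OF g] smult act operator)
qed

lemma (in left_module) left_module_hom_free_unique:
  assumes g: "left_module_hom K A (free_left_module A X) M g"
    and h: "left_module_hom K A (free_left_module A X) M h"
    and eq: "\<And>x. x \<in> X \<Longrightarrow> g (free_embedding A x) = h (free_embedding A x)"
    and u: "u \<in> carrier (free_left_module A X)"
  shows "g u = h u"
proof (rule additive_eq_if_eq_on_monomials[OF M.abelian_group_axioms _ _ _ u])
  show "additive (free_left_module A X) M g" "additive (free_left_module A X) M h"
    using g h unfolding left_module_hom_def by (blast intro: linear_map_additive)+
  show "g (a \<cdot>\<^bsub>free_left_module A X\<^esub> free_embedding A x) =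
      h (a \<cdot>\<^bsub>free_left_module A X\<^esub> free_embedding A x)" if "a \<in> carrier A" "x \<in> X" for a x
    using g h that free_embedding_closed[OF that(2)]
    by (simp only: left_module_hom_def eq)
qed

text \<open>
  Needed to choose the extensional representative of the lift: the conditions on a homomorphism only
  evaluate it on the carrier, because the carrier is closed under all operations and under \<open>NM\<close>.
\<close>

lemma (in nijenhuis_left_module) nijenhuis_module_hom_restrict:
  "nijenhuis_module_hom K A M NM M' NM' (restrict g (carrier M)) \<longleftrightarrow>
    nijenhuis_module_hom K A M NM M' NM' g"
proof -
  have "NM m \<in> carrier M" if "m \<in> carrier M" for m
    using NM_linear that by (auto simp: linear_map_def)
  then show ?thesis
    by (auto simp: nijenhuis_module_hom_def left_module_hom_def linear_map_def Pi_iff act_closed)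
qed

theorem theorem2p21:
  fixes K :: "('k, 'r) ring_scheme"
    and A :: "('k, 'a, 'u) module_scheme"
    and N :: "'a \<Rightarrow> 'a"
    and X :: "'x set"
  assumes "nijenhuis_algebra K A N"
  shows "nijenhuis_left_module K A N (free_left_module A X) (free_operator N)
    \<and> restricted_free_left_module TYPE('m) K A N X
        (free_left_module A X) (free_operator N) (free_embedding A)"
proof -
  let ?F = "free_left_module A X" and ?NF = "free_operator N :: ('x \<Rightarrow> 'a) \<Rightarrow> 'x \<Rightarrow> 'a"
  interpret nijenhuis_algebra K A N by fact
  interpret F: nijenhuis_left_module K A N ?F ?NF by (rule nijenhuis_left_module_free)
  have universal: "\<exists>!g. g \<in> extensional (carrier ?F) \<and> nijenhuis_module_hom K A ?F ?NF M NM g \<and>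
      (\<forall>x\<in>X. g (free_embedding A x) = f x)"
    if M: "nijenhuis_left_module K A N M NM" and f: "f \<in> X \<rightarrow> carrier M"
      and MC: "f ` X \<subseteq> MC A N M NM"
    for M :: "('k, 'a, 'm) lmodule" and NM f
  proof -
    interpret M: nijenhuis_left_module K A N M NM by (rule M)
    let ?g = "restrict (free_lift A M f) (carrier ?F)"
    have g: "nijenhuis_module_hom K A ?F ?NF M NM ?g"
      unfolding F.nijenhuis_module_hom_restrict
      by (rule M.nijenhuis_module_hom_free_lift[OF f MC])
    have g_embedding: "?g (free_embedding A x) = f x" if "x \<in> X" for x
    proof -
      have "free_lift A M f (\<one>\<^bsub>A\<^esub> \<cdot>\<^bsub>?F\<^esub> free_embedding A x) = \<one>\<^bsub>A\<^esub> \<cdot>\<^bsub>M\<^esub> f x"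
        by (rule M.free_lift_monomial[OF f _ that]) simp
      moreover have "f x \<in> carrier M" using f that by auto
      ultimately show ?thesis
        using free_embedding_closed[OF that]
        by (simp add: F.act_one M.act_one del: free_left_module_simps(4))
    qed
    show ?thesis
    proof (rule ex1I[of _ ?g])
      fix h
      assume h: "h \<in> extensional (carrier ?F) \<and> nijenhuis_module_hom K A ?F ?NF M NM h \<and>
        (\<forall>x\<in>X. h (free_embedding A x) = f x)"
      have "h u = ?g u" if "u \<in> carrier ?F" for u
        by (rule M.left_module_hom_free_unique[OF _ _ _ that])
          (use g h g_embedding in \<open>simp_all only: nijenhuis_module_hom_def\<close>)
      then show "h = ?g"
        using h by (intro extensionalityI[of _ "carrier ?F"]) auto
    qed (use g g_embedding in auto)
  qed
  have embedding: "free_embedding A \<in> X \<rightarrow> carrier ?F"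
    by (auto intro: free_embedding_closed)
  show ?thesis
    unfolding restricted_free_left_module_def
    by (intro conjI allI impI F.nijenhuis_left_module_axioms embedding universal) simp_all
qed

end
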